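(* Let $H$ be a complex Hilbert space regarded as a type I Cartan factor, $F$ an anisotropic Jordan Banach triple and $T:H\to F$ a generalised triple homomorphism. Then $T$ is continuous.
   Context: A complex (resp. real) Jordan Banach triple is a complex (resp. real) Banach space $E$ with a continuous triple product $\{\cdot,\cdot,\cdot\}:E^3\to E$ that is bilinear and symmetric in the outer variables and conjugate linear (resp. linear) in the middle one, satisfying the Jordan identity $L(a,b)L(x,y)-L(x,y)L(a,b)=L(L(a,b)x,y)-L(x,L(b,a)y)$, where $L(x,y)z=\{x,y,z\}$. It is anisotropic if $\{a,a,a\}=0$ implies $a=0$. A complex Hilbert space $H$ is regarded as a type I Cartan factor with its natural norm and the triple product $\{a,b,c\}=\frac12\big((a|b)c+(c|b)a\big)$, where $(\cdot|\cdot)$ is the inner product (linear in the first variable). A (not necessarily continuous) linear mapping $T:E\to F$ between Jordan Banach triples is a generalised triple homomorphism if there is $C>0$ with $\|T(\{a,b,c\})-\{T(a),T(b),T(c)\}\|\le C\|a\|\|b\|\|c\|$ for all $a,b,c\in E$. *)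

theory Defs
  imports "HOL-Analysis.Analysis"
begin

text \<open>
  Banach spaces are carried by types of class \<^class>\<open>banach\<close>, which supplies the real structure, the
  norm and completeness. A complex structure is an additional scalar multiplication compatible
  with these; keeping it explicit lets real and complex triples be treated side by side.
\<close>

locale complex_banach = vector_space scale
  for scale :: "complex \<Rightarrow> 'a::banach \<Rightarrow> 'a" +
  assumes scale_of_real: "scale (of_real r) x = r *\<^sub>R x"
    and norm_scale: "norm (scale c x) = cmod c * norm x"

text \<open>
  The inner product is linear in the first variable. Positive definiteness is contained in
  \<open>ip_self\<close>, which also says that the norm is the Hilbert norm.
\<close>

locale complex_hilbert = complex_banach scale
  for scale :: "complex \<Rightarrow> 'a::banach \<Rightarrow> 'a" +
  fixes ip :: "'a \<Rightarrow> 'a \<Rightarrow> complex"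
  assumes ip_add_left: "ip (x + y) z = ip x z + ip y z"
    and ip_scale_left: "ip (scale c x) y = c * ip x y"
    and ip_commute: "ip y x = cnj (ip x y)"
    and ip_self: "ip x x = of_real ((norm x)\<^sup>2)"

text \<open>
  The axioms common to real and complex Jordan Banach triples. With \<open>L x y z = tp x y z\<close>, the
  Jordan identity is the evaluation at \<open>z\<close> of
  \<open>L a b \<circ> L x y - L x y \<circ> L a b = L (L a b x) y - L x (L b a y)\<close>.
\<close>

locale jordan_triple_product =
  fixes tp :: "'a::banach \<Rightarrow> 'a \<Rightarrow> 'a \<Rightarrow> 'a"
  assumes tp_continuous: "continuous_on UNIV (\<lambda>(a, b, c). tp a b c)"
    and tp_symmetric: "tp a b c = tp c b a"
    and jordan_identity:
      "tp a b (tp x y z) - tp x y (tp a b z) = tp (tp a b x) y z - tp x (tp b a y) z"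

text \<open>Linearity in the third variable follows from the symmetry in the outer variables.\<close>

locale real_jordan_banach_triple = jordan_triple_product tp
  for tp :: "'a::banach \<Rightarrow> 'a \<Rightarrow> 'a \<Rightarrow> 'a" +
  assumes tp_linear_outer: "linear (\<lambda>a. tp a b c)"
    and tp_linear_middle: "linear (\<lambda>b. tp a b c)"

locale complex_jordan_banach_triple = complex_banach scale + jordan_triple_product tp
  for scale :: "complex \<Rightarrow> 'a::banach \<Rightarrow> 'a"
    and tp :: "'a \<Rightarrow> 'a \<Rightarrow> 'a \<Rightarrow> 'a" +
  assumes tp_clinear_outer: "Vector_Spaces.linear scale scale (\<lambda>a. tp a b c)"
    and tp_add_middle: "tp a (b + b') c = tp a b c + tp a b' c"
    and tp_scale_middle: "tp a (scale k b) c = scale (cnj k) (tp a b c)"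

definition anisotropic :: "('a::zero \<Rightarrow> 'a \<Rightarrow> 'a \<Rightarrow> 'a) \<Rightarrow> bool"
  where "anisotropic tp \<longleftrightarrow> (\<forall>a. tp a a a = 0 \<longrightarrow> a = 0)"

definition hilbert_triple ::
    "(complex \<Rightarrow> 'a \<Rightarrow> 'a) \<Rightarrow> ('a \<Rightarrow> 'a \<Rightarrow> complex) \<Rightarrow> 'a \<Rightarrow> 'a \<Rightarrow> 'a \<Rightarrow> 'a::ab_group_add"
  where "hilbert_triple s ip a b c = s (1/2) (s (ip a b) c + s (ip c b) a)"

text \<open>
  Linearity is over the scalar field of the two given scalar multiplications: \<open>scaleR\<close> for real
  triples, a complex scalar multiplication for complex ones.
\<close>

definition generalised_triple_hom ::
    "('k::field \<Rightarrow> 'a \<Rightarrow> 'a) \<Rightarrow> ('k \<Rightarrow> 'b \<Rightarrow> 'b) \<Rightarrow> ('a \<Rightarrow> 'a \<Rightarrow> 'a \<Rightarrow> 'a) \<Rightarrow>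
      ('b \<Rightarrow> 'b \<Rightarrow> 'b \<Rightarrow> 'b) \<Rightarrow> ('a::banach \<Rightarrow> 'b::banach) \<Rightarrow> bool"
  where "generalised_triple_hom s1 s2 tp1 tp2 T \<longleftrightarrow>
    Vector_Spaces.linear s1 s2 T \<and>
    (\<exists>C>0. \<forall>a b c. norm (T (tp1 a b c) - tp2 (T a) (T b) (T c)) \<le> C * norm a * norm b * norm c)"

text \<open>A complex Jordan Banach triple is also a real one.\<close>

lemma (in complex_jordan_banach_triple) real_jordan_banach_triple:
  "real_jordan_banach_triple tp"
proof (intro_locales, rule real_jordan_banach_triple_axioms.intro)
  show "linear (\<lambda>a. tp a b c)" for b c
  proof -
    interpret t: Vector_Spaces.linear scale scale "\<lambda>a. tp a b c"
      by (rule tp_clinear_outer)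
    show ?thesis
      by (rule linearI) (simp_all add: t.add t.scale flip: scale_of_real)
  qed
  show "linear (\<lambda>b. tp a b c)" for a c
    by (rule linearI) (simp_all add: tp_add_middle tp_scale_middle flip: scale_of_real)
qed

text \<open>A complex Hilbert space with this product is a complex Jordan Banach triple.\<close>

context complex_hilbert
begin

lemma ip_add_right: "ip x (y + z) = ip x y + ip x z"
  by (metis ip_add_left ip_commute complex_cnj_add)

lemma ip_scale_right: "ip x (scale c y) = cnj c * ip x y"
  by (metis ip_scale_left ip_commute complex_cnj_mult)

lemma Re_ip: "Re (ip x y) = ((norm (x + y))\<^sup>2 - (norm x)\<^sup>2 - (norm y)\<^sup>2) / 2"
proof -
  have "Re (ip (x + y) (x + y)) = Re (ip x x) + Re (ip y y) + 2 * Re (ip x y)"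
    using ip_commute[of y x] by (simp add: ip_add_left ip_add_right)
  then show ?thesis
    unfolding ip_self Re_complex_of_real by simp
qed

lemma Im_ip: "Im (ip x y) = Re (ip x (scale \<i> y))"
  by (simp add: ip_scale_right)

lemma scale_eq: "scale c x = Re c *\<^sub>R x + Im c *\<^sub>R scale \<i> x"
proof -
  have "scale (of_real (Re c) + of_real (Im c) * \<i>) x = Re c *\<^sub>R x + Im c *\<^sub>R scale \<i> x"
    unfolding scale_left_distrib scale_of_real scale_scale[symmetric] ..
  then show ?thesis
    by (metis complex_eq mult.commute)
qed

lemma continuous_on_scale_i: "continuous_on UNIV (scale \<i>)"
  by (intro linear_continuous_on bounded_linear_intro[where K = 1])
    (simp_all add: scale_right_distrib norm_scale mult.commute flip: scale_of_real)

lemma continuous_on_scale [continuous_intros]: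
  assumes "continuous_on S f" "continuous_on S g"
  shows "continuous_on S (\<lambda>x. scale (f x) (g x))"
proof -
  have "continuous_on S (\<lambda>x. Re (f x) *\<^sub>R g x + Im (f x) *\<^sub>R scale \<i> (g x))"
    by (intro continuous_intros assms continuous_on_compose2[OF continuous_on_scale_i]) auto
  then show ?thesis
    by (simp only: scale_eq[symmetric])
qed

lemma continuous_on_ip [continuous_intros]:
  assumes "continuous_on S f" "continuous_on S g"
  shows "continuous_on S (\<lambda>x. ip (f x) (g x))"
proof -
  have "continuous_on S (\<lambda>x. Complex (Re (ip (f x) (g x))) (Im (ip (f x) (g x))))"
    unfolding Complex_eq Im_ip Re_ip
    by (intro continuous_intros assms) auto
  then show ?thesis by simp
qed

lemma hilbert_triple_eq:
  "hilbert_triple scale ip a b c = scale (ip a b / 2) c + scale (ip c b / 2) a"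
  by (simp add: hilbert_triple_def scale_right_distrib)

theorem hilbert_triple_complex_jordan_banach_triple:
  "complex_jordan_banach_triple scale (hilbert_triple scale ip)"
proof (intro_locales, unfold_locales)
  let ?tp = "hilbert_triple scale ip"
  note ip_simps = ip_add_left ip_add_right ip_scale_left ip_scale_right
  note scale_simps = scale_right_distrib scale_left_distrib scale_scale
  show "continuous_on UNIV (\<lambda>(a, b, c). ?tp a b c)"
    unfolding hilbert_triple_def case_prod_beta
    by (intro continuous_intros)
  show "?tp a b c = ?tp c b a" for a b c
    by (simp add: hilbert_triple_eq add.commute)
  show "?tp a b (?tp x y z) - ?tp x y (?tp a b z) = ?tp (?tp a b x) y z - ?tp x (?tp b a y) z"
    for a b x y z
  proof -
    have cnj_ip: "cnj (ip u v / 2) = ip v u / 2" for u v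
      using ip_commute[of v u] by simp
    show ?thesis
      unfolding hilbert_triple_eq ip_simps cnj_ip add_divide_distrib scale_simps
        times_divide_eq_left times_divide_eq_right
      by (simp only: mult.commute diff_eq_eq add_ac) (simp add: add_ac mult_ac)
  qed
  show "?tp (a + a') b c = ?tp a b c + ?tp a' b c" for a a' b c
    unfolding hilbert_triple_eq ip_simps add_divide_distrib scale_simps
    by (simp only: add_ac)
  show "?tp (scale k a) b c = scale k (?tp a b c)" for k a b c
    unfolding hilbert_triple_eq ip_simps scale_simps
    by (simp add: mult.commute)
  show "?tp a (b + b') c = ?tp a b c + ?tp a b' c" for a b b' c
    unfolding hilbert_triple_eq ip_simps add_divide_distrib scale_simps
    by (simp only: add_ac)
  show "?tp a (scale k b) c = scale (cnj k) (?tp a b c)" for a k b c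
    unfolding hilbert_triple_eq ip_simps scale_simps
    by simp
qed

end

end

theory Submission
  imports Defs
begin

text \<open>
  On a Hilbert triple \<open>{x,x,x} = \<parallel>x\<parallel>\<^sup>2 x\<close>. So if \<open>x\<^sub>n \<rightarrow> 0\<close> and \<open>T x\<^sub>n \<rightarrow> z\<close>, then
  \<open>T {x\<^sub>n,x\<^sub>n,x\<^sub>n} = \<parallel>x\<^sub>n\<parallel>\<^sup>2 T x\<^sub>n \<rightarrow> 0\<close>, while the defect \<open>T {x\<^sub>n,x\<^sub>n,x\<^sub>n} - {T x\<^sub>n,T x\<^sub>n,T x\<^sub>n}\<close> is
  \<open>O(\<parallel>x\<^sub>n\<parallel>\<^sup>3)\<close>. Hence \<open>{z,z,z} = 0\<close>, so \<open>z = 0\<close> by anisotropy, and \<open>T\<close> is continuous by the closed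
  graph theorem. Only real homogeneity of \<open>T\<close> enters, so real and complex triples are treated alike.
\<close>

text \<open>Baire's theorem in contrapositive form: if all the closures had empty interior, so would
  their union, which is the whole space.\<close>

lemma Baire_closure_cover:
  fixes A :: "nat \<Rightarrow> 'a::banach set"
  assumes "(\<Union>n. A n) = UNIV"
  obtains n x r where "r > 0" "ball x r \<subseteq> closure (A n)"
proof -
  have "\<exists>n. interior (closure (A n)) \<noteq> {}"
  proof (rule ccontr)
    assume none: "\<not> ?thesis"
    have "Met_TC.mtopology interior_of \<Union>(range (\<lambda>n. closure (A n))) = {}"
      by (rule Met_TC.metric_Baire_category_alt)
        (use none in \<open>auto simp: complete_UNIV\<close>)
    moreover have "\<Union>(range (\<lambda>n. closure (A n))) = UNIV"
      using assms closure_subset by blast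
    ultimately show False by simp
  qed
  then show thesis
    using that by (metis all_not_in_conv mem_interior)
qed

text \<open>The sublevel sets of \<open>norm (T x)\<close> cover the space, so by Baire one of them
  is dense in some ball. Differences of its points, rescaled, reach every direction. The bound holds
  only at points \<open>y\<close> arbitrarily close to \<open>x\<close>; \<open>M\<close> depends on
  neither \<open>x\<close> nor \<open>e\<close>. The closed graph later transfers such a bound to
  \<open>x\<close> itself.\<close>

lemma linear_almost_bounded:
  fixes T :: "'a::banach \<Rightarrow> 'b::real_normed_vector"
  assumes "linear T"
  obtains M where "\<And>x e. e > 0 \<Longrightarrow> \<exists>y. norm (x - y) < e \<and> norm (T y) \<le> M * norm x"
proof -
  interpret linear T by fact
  have "(\<Union>n. {x. norm (T x) \<le> real n}) = UNIV"
    using real_arch_simple by auto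
  then obtain n x0 r where r: "r > 0" and ball: "ball x0 r \<subseteq> closure {x. norm (T x) \<le> real n}"
    by (rule Baire_closure_cover)
  have near: "\<exists>y. norm (y - z) < e \<and> norm (T y) \<le> real n" if "dist x0 z < r" "e > 0" for z e
  proof -
    have "z \<in> closure {x. norm (T x) \<le> real n}"
      using that(1) ball by auto
    then show ?thesis
      using that(2) by (auto simp: closure_approachable dist_norm)
  qed
  show thesis
  proof
    fix x :: 'a and e :: real
    assume "e > 0"
    show "\<exists>y. norm (x - y) < e \<and> norm (T y) \<le> (4 * real n / r) * norm x"
    proof (cases "x = 0")
      case True
      with \<open>e > 0\<close> show ?thesis by (intro exI[of _ 0]) (simp add: zero)
    next
      case False
      \<comment> \<open>With this \<open>c\<close>, the vector \<open>x /\<^sub>R c\<close> has norm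
        \<open>r / 2\<close>, so both \<open>x0\<close> and \<open>x0 + x /\<^sub>R c\<close> lie in
        the ball. Approximating each within \<open>e / (2 * c)\<close> and multiplying the
        difference by \<open>c\<close> gives total error below \<open>e\<close>.\<close>
      define c where "c = 2 * norm x / r"
      have c: "c > 0" using False r by (simp add: c_def)
      have e: "e / (2 * c) > 0" using c \<open>e > 0\<close> by simp
      have "dist x0 (x0 + x /\<^sub>R c) < r"
        using r False by (simp add: dist_norm c_def divide_simps)
      from near[OF this e] obtain y1 where
        y1: "norm (y1 - (x0 + x /\<^sub>R c)) < e / (2 * c)" "norm (T y1) \<le> real n" by blast
      have "dist x0 x0 < r" using r by simp
      from near[OF this e] obtain y0 where
        y0: "norm (y0 - x0) < e / (2 * c)" "norm (T y0) \<le> real n" by blast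
      let ?y = "c *\<^sub>R (y1 - y0)"
      have "x - ?y = c *\<^sub>R ((y0 - x0) - (y1 - (x0 + x /\<^sub>R c)))"
        using c by (simp add: algebra_simps)
      then have "norm (x - ?y) = c * norm ((y0 - x0) - (y1 - (x0 + x /\<^sub>R c)))"
        using c by simp
      also have "\<dots> < c * (e / (2 * c) + e / (2 * c))"
        by (intro mult_strict_left_mono c le_less_trans[OF norm_triangle_ineq4]) (use y0 y1 in linarith)
      also have "\<dots> = e" using c by (simp add: field_simps)
      finally have 1: "norm (x - ?y) < e" .
      have "norm (T ?y) = c * norm (T y1 - T y0)"
        using c by (simp add: scale diff)
      also have "\<dots> \<le> c * (real n + real n)"
        using c y0 y1 by (intro mult_left_mono norm_triangle_le_diff) auto
      also have "\<dots> = (4 * real n / r) * norm x"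
        by (simp add: c_def)
      finally show ?thesis using 1 by blast
    qed
  qed
qed

text \<open>By linearity it suffices to require closedness of the graph at 0. Successive
  approximation expands \<open>x\<close> into a series whose images under \<open>T\<close> are
  dominated by a geometric series; closedness identifies their sum with \<open>T x\<close>.\<close>

theorem closed_graph_bounded_linear:
  fixes T :: "'a::banach \<Rightarrow> 'b::banach"
  assumes "linear T"
    and closed: "\<And>X z. X \<longlonglongrightarrow> 0 \<Longrightarrow> (\<lambda>n. T (X n)) \<longlonglongrightarrow> z \<Longrightarrow> z = 0"
  shows "bounded_linear T"
proof -
  interpret linear T by fact
  obtain M where M: "\<And>x e. e > 0 \<Longrightarrow> \<exists>y. norm (x - y) < e \<and> norm (T y) \<le> M * norm x"
    using linear_almost_bounded[OF \<open>linear T\<close>] by blast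
  define K where "K = \<bar>M\<bar>"
  have K: "K \<ge> 0" by (simp add: K_def)
  have bound: "norm (T x) \<le> norm x * (2 * K)" for x
  proof (cases "x = 0")
    case True
    then show ?thesis by (simp add: zero)
  next
    case False
    \<comment> \<open>\<open>R n\<close> is the remainder of \<open>x\<close> after \<open>n\<close>
      approximants have been subtracted, and \<open>R n - R (Suc n)\<close> is the next
      approximant.\<close>
    have "\<exists>R. R 0 = x \<and> (\<forall>n. norm (R n) \<le> norm x * (1/2)^n \<and>
            norm (T (R n - R (Suc n))) \<le> norm x * K * (1/2)^n)"
    proof -
      \<comment> \<open>Dependent choice leaves the initial value free; the conjunct for
        \<open>n = 0\<close> pins it to \<open>x\<close>.\<close>
      have "\<exists>R. \<forall>n. (norm (R n) \<le> norm x * (1/2)^n \<and> (n = 0 \<longrightarrow> R n = x)) \<and>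
             norm (T (R n - R (Suc n))) \<le> norm x * K * (1/2)^n"
      proof (rule dependent_nat_choice
          [where P = "\<lambda>n v. norm v \<le> norm x * (1/2)^n \<and> (n = 0 \<longrightarrow> v = x)"
            and Q = "\<lambda>n v w. norm (T (v - w)) \<le> norm x * K * (1/2)^n"])
        show "\<exists>v. norm v \<le> norm x * (1/2)^0 \<and> (0 = (0::nat) \<longrightarrow> v = x)" by auto
      next
        fix v n assume v: "norm v \<le> norm x * (1/2)^n \<and> (n = 0 \<longrightarrow> v = x)"
        \<comment> \<open>The tolerance is the bound required of the next remainder
          \<open>v - y\<close>; it is positive because \<open>x\<close> is nonzero.\<close>
        have "norm x * (1/2)^Suc n > 0" using False by simp
        from M[OF this, of v] obtain y where
          y: "norm (v - y) < norm x * (1/2)^Suc n" "norm (T y) \<le> M * norm v" by blast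
        have "norm (T y) \<le> K * norm v"
          using y(2) by (rule order_trans) (simp add: K_def mult_right_mono)
        also have "\<dots> \<le> K * (norm x * (1/2)^n)"
          using v K by (intro mult_left_mono) auto
        finally have "norm (T (v - (v - y))) \<le> norm x * K * (1/2)^n"
          by (simp add: mult_ac)
        with y(1) show "\<exists>w. (norm w \<le> norm x * (1/2)^Suc n \<and> (Suc n = 0 \<longrightarrow> w = x)) \<and>
            norm (T (v - w)) \<le> norm x * K * (1/2)^n"
          by (intro exI[of _ "v - y"]) auto
      qed
      then show ?thesis by blast
    qed
    then obtain R where R0: "R 0 = x" and R: "\<And>n. norm (R n) \<le> norm x * (1/2)^n"
      and TR: "\<And>n. norm (T (R n - R (Suc n))) \<le> norm x * K * (1/2)^n" by blast
    let ?s = "\<Sum>n. T (R n - R (Suc n))"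
    have geo: "(\<lambda>n. norm x * K * (1/2)^n) sums (norm x * K * 2)"
      using sums_mult[OF geometric_sums[of "1/2::real"], of "norm x * K"] by simp
    have summ: "summable (\<lambda>n. T (R n - R (Suc n)))"
      by (rule summable_comparison_test'[OF sums_summable[OF geo]]) (rule TR)
    have "norm ?s \<le> (\<Sum>n. norm x * K * (1/2)^n)"
      by (rule norm_suminf_le[OF TR sums_summable[OF geo]])
    also have "\<dots> = norm x * (2 * K)"
      using sums_unique[OF geo] by simp
    finally have "norm ?s \<le> norm x * (2 * K)" .
    moreover have "T x = ?s"
    proof -
      \<comment> \<open>Closedness is applied to the remainders: they tend to 0, while by
        telescoping their images tend to \<open>T x - ?s\<close>.\<close>
      have "R \<longlonglongrightarrow> 0"
        by (rule Lim_null_comparison[where g = "\<lambda>n. norm x * (1/2)^n"])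
          (use R tendsto_mult_right_zero[OF LIMSEQ_power_zero[of "1/2::real"]] in simp_all)
      moreover have "(\<lambda>n. T (R n)) \<longlonglongrightarrow> T x - ?s"
      proof -
        have "T (R n) = T x - (\<Sum>k<n. T (R k - R (Suc k)))" for n
          by (induction n) (simp_all add: diff R0)
        then show ?thesis
          using summable_LIMSEQ[OF summ] by (auto intro!: tendsto_intros)
      qed
      ultimately have "T x - ?s = 0" by (rule closed)
      then show ?thesis by simp
    qed
    ultimately show ?thesis by simp
  qed
  show ?thesis
    by (rule bounded_linear_intro[OF add scale bound])
qed

lemma (in complex_hilbert) hilbert_triple_self:
  "hilbert_triple scale ip x x x = (norm x)\<^sup>2 *\<^sub>R x"
proof -
  have "hilbert_triple scale ip x x x = scale (of_real ((norm x)\<^sup>2)) x"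
    unfolding hilbert_triple_eq ip_self scale_left_distrib[symmetric] by simp
  then show ?thesis by (simp only: scale_of_real)
qed

lemma generalised_hilbert_triple_hom_bounded_linear:
  fixes T :: "'h::banach \<Rightarrow> 'f::banach"
  assumes H: "complex_hilbert scaleH ip" and F: "real_jordan_banach_triple tp"
    and T: "generalised_triple_hom scaleR scaleR (hilbert_triple scaleH ip) tp T"
    and aniso: "anisotropic tp"
  shows "bounded_linear T"
proof (rule closed_graph_bounded_linear)
  interpret H: complex_hilbert scaleH ip by fact
  interpret F: real_jordan_banach_triple tp by fact
  show "linear T"
    using T unfolding generalised_triple_hom_def linear_def by blast
  then interpret linear T .
  obtain C where C: "\<And>a b c. norm (T (hilbert_triple scaleH ip a b c) - tp (T a) (T b) (T c))
      \<le> C * norm a * norm b * norm c"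
    using T unfolding generalised_triple_hom_def by blast
  fix X z
  assume X: "X \<longlonglongrightarrow> 0" and TX: "(\<lambda>n. T (X n)) \<longlonglongrightarrow> z"
  note norm_X = tendsto_norm_zero[OF X]
  have "isCont (\<lambda>(a, b, c). tp a b c) (z, z, z)"
    using F.tp_continuous by (simp add: continuous_on_eq_continuous_at)
  from isCont_tendsto_compose[OF this tendsto_Pair[OF TX tendsto_Pair[OF TX TX]]]
  have "(\<lambda>n. tp (T (X n)) (T (X n)) (T (X n))) \<longlonglongrightarrow> tp z z z" by simp
  moreover have "(\<lambda>n. tp (T (X n)) (T (X n)) (T (X n))) \<longlonglongrightarrow> 0"
  proof -
    \<comment> \<open>By \<open>hilbert_triple_self\<close> and homogeneity the first term is
      \<open>T\<close> of the triple cube of \<open>X n\<close>, so this sequence is the defect on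
      the diagonal.\<close>
    have "(\<lambda>n. (norm (X n))\<^sup>2 *\<^sub>R T (X n) - tp (T (X n)) (T (X n)) (T (X n))) \<longlonglongrightarrow> 0"
    proof (rule Lim_null_comparison)
      show "\<forall>\<^sub>F n in sequentially. norm ((norm (X n))\<^sup>2 *\<^sub>R T (X n) - tp (T (X n)) (T (X n)) (T (X n)))
          \<le> C * norm (X n) * norm (X n) * norm (X n)"
        using C[of "X n" "X n" "X n" for n] by (simp add: H.hilbert_triple_self scale)
      show "(\<lambda>n. C * norm (X n) * norm (X n) * norm (X n)) \<longlonglongrightarrow> 0"
        using tendsto_mult[OF tendsto_mult[OF tendsto_mult[OF tendsto_const norm_X] norm_X] norm_X, of C]
        by simp
    qed
    \<comment> \<open>Convergence of \<open>T (X n)\<close> keeps the second factor bounded while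
      the first vanishes.\<close>
    moreover have "(\<lambda>n. (norm (X n))\<^sup>2 *\<^sub>R T (X n)) \<longlonglongrightarrow> 0"
      using tendsto_scaleR[OF tendsto_power[OF norm_X, of 2] TX] by simp
    ultimately have "(\<lambda>n. (norm (X n))\<^sup>2 *\<^sub>R T (X n) -
        ((norm (X n))\<^sup>2 *\<^sub>R T (X n) - tp (T (X n)) (T (X n)) (T (X n)))) \<longlonglongrightarrow> 0 - 0"
      by (rule tendsto_diff[rotated])
    then show ?thesis by simp
  qed
  ultimately have "tp z z z = 0" by (rule LIMSEQ_unique)
  with aniso show "z = 0" unfolding anisotropic_def by blast
qed

text \<open>This reduces the complex case to the real one: \<open>scale_of_real\<close> turns
  complex homogeneity at real scalars into real homogeneity, and the defect bound does not mention
  scalars.\<close>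

lemma generalised_triple_hom_restrict_scalars:
  assumes "complex_banach s1" "complex_banach s2" "generalised_triple_hom s1 s2 tp1 tp2 T"
  shows "generalised_triple_hom scaleR scaleR tp1 tp2 T"
proof -
  interpret E: complex_banach s1 by fact
  interpret F: complex_banach s2 by fact
  interpret T: Vector_Spaces.linear s1 s2 T
    using assms(3) by (simp add: generalised_triple_hom_def)
  have "linear T"
    by (rule linearI) (simp_all add: T.add T.scale flip: E.scale_of_real F.scale_of_real)
  with assms(3) show ?thesis
    unfolding generalised_triple_hom_def linear_def by blast
qed

theorem lemma15:
  fixes scaleH :: "complex \<Rightarrow> 'h::banach \<Rightarrow> 'h"
    and ip :: "'h \<Rightarrow> 'h \<Rightarrow> complex"
    and scaleF :: "complex \<Rightarrow> 'f::banach \<Rightarrow> 'f"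
    and tp :: "'f \<Rightarrow> 'f \<Rightarrow> 'f \<Rightarrow> 'f"
    and T :: "'h \<Rightarrow> 'f"
  assumes "complex_hilbert scaleH ip"
    and "complex_jordan_banach_triple scaleF tp \<and>
           generalised_triple_hom scaleH scaleF (hilbert_triple scaleH ip) tp T
         \<or> real_jordan_banach_triple tp \<and>
           generalised_triple_hom scaleR scaleR (hilbert_triple scaleH ip) tp T"
    and "anisotropic tp"
  shows "continuous_on UNIV T"
proof -
  have "real_jordan_banach_triple tp \<and>
      generalised_triple_hom scaleR scaleR (hilbert_triple scaleH ip) tp T"
    using assms(2)
  proof
    assume "complex_jordan_banach_triple scaleF tp \<and>
      generalised_triple_hom scaleH scaleF (hilbert_triple scaleH ip) tp T"
    moreover have "complex_banach scaleH"
      using assms(1) by (rule complex_hilbert.axioms)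
    ultimately show ?thesis
      using generalised_triple_hom_restrict_scalars complex_jordan_banach_triple.axioms(1)
        complex_jordan_banach_triple.real_jordan_banach_triple by blast
  qed
  then have "bounded_linear T"
    using generalised_hilbert_triple_hom_bounded_linear assms(1,3) by blast
  then show ?thesis by (rule linear_continuous_on)
qed

end
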